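(* Let $n\geq 2$ be an integer. Then the dihedral group $D_{2n}$ of order $2n$ is a $\mathrm{BCI}$-group if and only if $n\in\{2,3,5\}$.
   Context: $D_{2n}=\langle a,b\mid a^n=b^2=(ab)^2=1\rangle$ is the dihedral group of order $2n$ (so $D_4\cong\mathbb{Z}_2\times\mathbb{Z}_2$). Graphs are finite, simple and undirected. For a finite group $G$ and a subset $S\subseteq G$, the bi-Cayley graph $\mathrm{BCay}(G,S)$ has vertex set $G\times\{1,2\}$ and edge set $\{\{(g,1),(sg,2)\}\mid g\in G,\ s\in S\}$. It is a $\mathrm{BCI}$-graph if whenever $\mathrm{BCay}(G,S)\cong\mathrm{BCay}(G,T)$ for some $T\subseteq G$, then $T=gS^{\alpha}$ for some $g\in G$ and $\alpha\in\mathrm{Aut}(G)$, where $S^\alpha$ is the image of $S$ under $\alpha$. A group $G$ is a $\mathrm{BCI}$-group if every bi-Cayley graph over $G$ is a $\mathrm{BCI}$-graph. *)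

theory Defs
  imports "HOL-Algebra.Algebra"
begin

text \<open>
  The pair \<open>(i, r)\<close> stands for \<open>a\<^sup>i b\<^sup>r\<close> with \<open>i\<close> modulo \<open>n\<close>; the multiplication comes from
  \<open>b a = a\<^sup>-\<^sup>1 b\<close>. The lemmas below show that for \<open>n \<ge> 1\<close> this is the group presented by
  \<open>\<langle>a, b | a\<^sup>n = b\<^sup>2 = (ab)\<^sup>2 = 1\<rangle>\<close>, and that its order is \<open>2n\<close>.
\<close>

definition dihedral_group :: "nat \<Rightarrow> (int \<times> bool) monoid" where
  "dihedral_group n =
    \<lparr>carrier = {0..<int n} \<times> UNIV,
     monoid.mult = (\<lambda>(i, r) (j, s). ((if r then i - j else i + j) mod int n, r \<noteq> s)),
     one = (0, False)\<rparr>"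

definition dihedral_a :: "nat \<Rightarrow> int \<times> bool" where
  "dihedral_a n = (1 mod int n, False)"

definition dihedral_b :: "int \<times> bool" where
  "dihedral_b = (0, True)"

lemma group_dihedral_group:
  assumes "n \<ge> 1"
  shows "group (dihedral_group n)"
proof (rule groupI)
  fix x y z
  assume "x \<in> carrier (dihedral_group n)" "y \<in> carrier (dihedral_group n)"
    "z \<in> carrier (dihedral_group n)"
  then show "x \<otimes>\<^bsub>dihedral_group n\<^esub> y \<otimes>\<^bsub>dihedral_group n\<^esub> z =
      x \<otimes>\<^bsub>dihedral_group n\<^esub> (y \<otimes>\<^bsub>dihedral_group n\<^esub> z)"
    by (auto simp: dihedral_group_def mod_simps algebra_simps)
next
  fix x
  assume x: "x \<in> carrier (dihedral_group n)"
  obtain i r where ir: "x = (i, r)" by (cases x)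
  let ?y = "((if r then i else - i) mod int n, r)"
  have "?y \<in> carrier (dihedral_group n)"
    using assms by (simp add: dihedral_group_def)
  moreover have "?y \<otimes>\<^bsub>dihedral_group n\<^esub> x = \<one>\<^bsub>dihedral_group n\<^esub>"
    by (auto simp: dihedral_group_def ir mod_simps)
  ultimately show "\<exists>y\<in>carrier (dihedral_group n). y \<otimes>\<^bsub>dihedral_group n\<^esub> x = \<one>\<^bsub>dihedral_group n\<^esub>"
    by blast
qed (use assms in \<open>auto simp: dihedral_group_def\<close>)

lemma order_dihedral_group: "order (dihedral_group n) = 2 * n"
  by (simp add: order_def dihedral_group_def card_cartesian_product)

lemma finite_dihedral_group: "finite (carrier (dihedral_group n))"
  by (simp add: dihedral_group_def)

lemma dihedral_a_closed: "n \<ge> 1 \<Longrightarrow> dihedral_a n \<in> carrier (dihedral_group n)"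
  by (simp add: dihedral_group_def dihedral_a_def)

lemma dihedral_b_closed: "n \<ge> 1 \<Longrightarrow> dihedral_b \<in> carrier (dihedral_group n)"
  by (simp add: dihedral_group_def dihedral_b_def)

lemma dihedral_a_pow:
  "dihedral_a n [^]\<^bsub>dihedral_group n\<^esub> (k::nat) = (int k mod int n, False)"
  by (induction k) (auto simp: dihedral_group_def dihedral_a_def nat_pow_def mod_simps algebra_simps)

lemma dihedral_relations:
  assumes "n \<ge> 1"
  shows "dihedral_a n [^]\<^bsub>dihedral_group n\<^esub> n = \<one>\<^bsub>dihedral_group n\<^esub>"
    and "dihedral_b [^]\<^bsub>dihedral_group n\<^esub> (2::nat) = \<one>\<^bsub>dihedral_group n\<^esub>"
    and "(dihedral_a n \<otimes>\<^bsub>dihedral_group n\<^esub> dihedral_b) [^]\<^bsub>dihedral_group n\<^esub> (2::nat) = \<one>\<^bsub>dihedral_group n\<^esub>"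
proof -
  show "dihedral_a n [^]\<^bsub>dihedral_group n\<^esub> n = \<one>\<^bsub>dihedral_group n\<^esub>"
    unfolding dihedral_a_pow by (simp add: dihedral_group_def)
  show "dihedral_b [^]\<^bsub>dihedral_group n\<^esub> (2::nat) = \<one>\<^bsub>dihedral_group n\<^esub>"
    by (simp add: numeral_2_eq_2 nat_pow_def dihedral_group_def dihedral_b_def)
  show "(dihedral_a n \<otimes>\<^bsub>dihedral_group n\<^esub> dihedral_b) [^]\<^bsub>dihedral_group n\<^esub> (2::nat) = \<one>\<^bsub>dihedral_group n\<^esub>"
    by (simp add: numeral_2_eq_2 nat_pow_def dihedral_group_def dihedral_a_def dihedral_b_def)
qed

lemma dihedral_normal_form:
  assumes "(i, r) \<in> carrier (dihedral_group n)"
  shows "(i, r) = dihedral_a n [^]\<^bsub>dihedral_group n\<^esub> nat i \<otimes>\<^bsub>dihedral_group n\<^esub>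
      (if r then dihedral_b else \<one>\<^bsub>dihedral_group n\<^esub>)"
  using assms unfolding dihedral_a_pow by (auto simp: dihedral_group_def dihedral_b_def)

lemma dihedral_generate:
  assumes "n \<ge> 1"
  shows "generate (dihedral_group n) {dihedral_a n, dihedral_b} = carrier (dihedral_group n)"
proof -
  interpret D: group "dihedral_group n" by (rule group_dihedral_group[OF assms])
  let ?D = "dihedral_group n"
  let ?X = "{dihedral_a n, dihedral_b}"
  have pow: "dihedral_a n [^]\<^bsub>?D\<^esub> (k::nat) \<in> generate ?D ?X" for k
  proof (induction k)
    case 0
    then show ?case by (simp add: generate.one)
  next
    case (Suc k)
    then show ?case by (simp add: generate.eng generate.incl)
  qed
  have "x \<in> generate ?D ?X" if "x \<in> carrier ?D" for x
  proof -
    obtain i r where ir: "x = (i, r)" by (cases x)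
    have e: "(if r then dihedral_b else \<one>\<^bsub>?D\<^esub>) \<in> generate ?D ?X"
      by (simp add: generate.one generate.incl)
    have "dihedral_a n [^]\<^bsub>?D\<^esub> nat i \<otimes>\<^bsub>?D\<^esub> (if r then dihedral_b else \<one>\<^bsub>?D\<^esub>) \<in> generate ?D ?X"
      by (rule generate.eng[OF pow e])
    then show ?thesis using dihedral_normal_form that unfolding ir by metis
  qed
  moreover have "generate ?D ?X \<subseteq> carrier ?D"
    by (rule D.generate_incl) (use assms dihedral_a_closed dihedral_b_closed in auto)
  ultimately show ?thesis by blast
qed

lemma dihedral_universal:
  assumes n: "n \<ge> 1" and H: "group H"
    and a: "a \<in> carrier H" and b: "b \<in> carrier H"
    and rel: "a [^]\<^bsub>H\<^esub> n = \<one>\<^bsub>H\<^esub>" "b [^]\<^bsub>H\<^esub> (2::nat) = \<one>\<^bsub>H\<^esub>"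
      "(a \<otimes>\<^bsub>H\<^esub> b) [^]\<^bsub>H\<^esub> (2::nat) = \<one>\<^bsub>H\<^esub>"
  shows "\<exists>h\<in>hom (dihedral_group n) H. h (dihedral_a n) = a \<and> h dihedral_b = b"
proof -
  interpret H: group H by (rule H)
  let ?h = "\<lambda>(i::int, r::bool). a [^]\<^bsub>H\<^esub> i \<otimes>\<^bsub>H\<^esub> (if r then b else \<one>\<^bsub>H\<^esub>)"
  have rel_int: "a [^]\<^bsub>H\<^esub> int n = \<one>\<^bsub>H\<^esub>"
    using rel(1) by (simp add: int_pow_int)
  have modn: "a [^]\<^bsub>H\<^esub> (i mod int n) = a [^]\<^bsub>H\<^esub> i" for i :: int
  proof -
    have "a [^]\<^bsub>H\<^esub> i = a [^]\<^bsub>H\<^esub> (int n * (i div int n) + i mod int n)" by simp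
    also have "\<dots> = (a [^]\<^bsub>H\<^esub> int n) [^]\<^bsub>H\<^esub> (i div int n) \<otimes>\<^bsub>H\<^esub> a [^]\<^bsub>H\<^esub> (i mod int n)"
      using a by (simp only: H.int_pow_mult H.int_pow_pow)
    finally show ?thesis using a by (simp add: rel_int)
  qed
  have bb: "b \<otimes>\<^bsub>H\<^esub> b = \<one>\<^bsub>H\<^esub>"
    using rel(2) b by (simp add: numeral_2_eq_2)
  have "a \<otimes>\<^bsub>H\<^esub> b \<otimes>\<^bsub>H\<^esub> (a \<otimes>\<^bsub>H\<^esub> b) = \<one>\<^bsub>H\<^esub>"
    using rel(3) a b by (simp add: numeral_2_eq_2)
  then have "a \<otimes>\<^bsub>H\<^esub> (b \<otimes>\<^bsub>H\<^esub> a \<otimes>\<^bsub>H\<^esub> b) = \<one>\<^bsub>H\<^esub>"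
    using a b by (simp add: H.m_assoc)
  then have conj: "b \<otimes>\<^bsub>H\<^esub> a \<otimes>\<^bsub>H\<^esub> b = inv\<^bsub>H\<^esub> a"
    using a b by (metis H.inv_equality H.inv_inv H.inv_closed H.m_closed)
  have invb: "inv\<^bsub>H\<^esub> b = b" using bb b by (rule H.inv_equality) (rule b)
  have conj_hom: "(\<lambda>x. b \<otimes>\<^bsub>H\<^esub> x \<otimes>\<^bsub>H\<^esub> b) \<in> hom H H"
  proof (rule homI)
    fix x y assume xy: "x \<in> carrier H" "y \<in> carrier H"
    have "b \<otimes>\<^bsub>H\<^esub> x \<otimes>\<^bsub>H\<^esub> b \<otimes>\<^bsub>H\<^esub> (b \<otimes>\<^bsub>H\<^esub> y \<otimes>\<^bsub>H\<^esub> b) = b \<otimes>\<^bsub>H\<^esub> x \<otimes>\<^bsub>H\<^esub> ((b \<otimes>\<^bsub>H\<^esub> b) \<otimes>\<^bsub>H\<^esub> (y \<otimes>\<^bsub>H\<^esub> b))"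
      using xy b by (simp add: H.m_assoc)
    then show "b \<otimes>\<^bsub>H\<^esub> (x \<otimes>\<^bsub>H\<^esub> y) \<otimes>\<^bsub>H\<^esub> b = b \<otimes>\<^bsub>H\<^esub> x \<otimes>\<^bsub>H\<^esub> b \<otimes>\<^bsub>H\<^esub> (b \<otimes>\<^bsub>H\<^esub> y \<otimes>\<^bsub>H\<^esub> b)"
      using xy b bb by (simp add: H.m_assoc)
  qed (use b in simp)
  interpret C: group_hom H H "\<lambda>x. b \<otimes>\<^bsub>H\<^esub> x \<otimes>\<^bsub>H\<^esub> b"
    by (rule group_hom.intro) (use conj_hom H in \<open>auto simp: group_hom_axioms_def\<close>)
  have conj_pow: "b \<otimes>\<^bsub>H\<^esub> a [^]\<^bsub>H\<^esub> j \<otimes>\<^bsub>H\<^esub> b = a [^]\<^bsub>H\<^esub> (- j)" for j :: int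
  proof -
    have "b \<otimes>\<^bsub>H\<^esub> a [^]\<^bsub>H\<^esub> j \<otimes>\<^bsub>H\<^esub> b = (b \<otimes>\<^bsub>H\<^esub> a \<otimes>\<^bsub>H\<^esub> b) [^]\<^bsub>H\<^esub> j"
      by (rule C.hom_int_pow[OF a])
    then show ?thesis using a by (simp add: conj H.int_pow_inv H.int_pow_neg)
  qed
  have swap: "b \<otimes>\<^bsub>H\<^esub> a [^]\<^bsub>H\<^esub> j = a [^]\<^bsub>H\<^esub> (- j) \<otimes>\<^bsub>H\<^esub> b" for j :: int
  proof -
    have "a [^]\<^bsub>H\<^esub> (- j) \<otimes>\<^bsub>H\<^esub> b = b \<otimes>\<^bsub>H\<^esub> a [^]\<^bsub>H\<^esub> j \<otimes>\<^bsub>H\<^esub> (b \<otimes>\<^bsub>H\<^esub> b)"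
      using a b unfolding conj_pow[symmetric] by (simp add: H.m_assoc)
    then show ?thesis using a b by (simp add: bb)
  qed
  have mult: "?h (x \<otimes>\<^bsub>dihedral_group n\<^esub> y) = ?h x \<otimes>\<^bsub>H\<^esub> ?h y" for x y
  proof -
    obtain i r j s where xy: "x = (i, r)" "y = (j, s)" by (cases x, cases y)
    have s: "(if s then b else \<one>\<^bsub>H\<^esub>) \<in> carrier H" using b by simp
    show ?thesis
    proof (cases r)
      case True
      have "?h x \<otimes>\<^bsub>H\<^esub> ?h y = a [^]\<^bsub>H\<^esub> i \<otimes>\<^bsub>H\<^esub> (b \<otimes>\<^bsub>H\<^esub> a [^]\<^bsub>H\<^esub> j) \<otimes>\<^bsub>H\<^esub> (if s then b else \<one>\<^bsub>H\<^esub>)"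
        using a b s True by (simp add: xy H.m_assoc)
      also have "\<dots> = a [^]\<^bsub>H\<^esub> i \<otimes>\<^bsub>H\<^esub> a [^]\<^bsub>H\<^esub> (- j) \<otimes>\<^bsub>H\<^esub> (b \<otimes>\<^bsub>H\<^esub> (if s then b else \<one>\<^bsub>H\<^esub>))"
        using a b s by (simp add: swap H.m_assoc)
      also have "\<dots> = a [^]\<^bsub>H\<^esub> (i - j) \<otimes>\<^bsub>H\<^esub> (if s then \<one>\<^bsub>H\<^esub> else b)"
        using a b by (simp add: bb H.int_pow_mult[symmetric])
      finally show ?thesis using True by (simp add: xy dihedral_group_def modn)
    next
      case False
      then show ?thesis using a b
        by (simp add: xy dihedral_group_def modn H.int_pow_mult H.m_assoc)
    qed
  qed
  have "?h \<in> hom (dihedral_group n) H"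
    by (rule homI) (use a b mult in \<open>auto\<close>)
  moreover have "?h (dihedral_a n) = a" using a by (simp add: dihedral_a_def modn)
  moreover have "?h dihedral_b = b" using b by (simp add: dihedral_b_def)
  ultimately show ?thesis by blast
qed

text \<open>
  A graph is a pair of a vertex set and a set of edges. The type does not enforce that edges are
  two-element sets of vertices; that is \<open>simple_graph\<close>, which holds for the graphs used here.
\<close>

type_synonym 'v graph = "'v set \<times> 'v set set"

definition simple_graph :: "'v graph \<Rightarrow> bool" where
  "simple_graph \<Gamma> \<longleftrightarrow> finite (fst \<Gamma>) \<and> (\<forall>e\<in>snd \<Gamma>. e \<subseteq> fst \<Gamma> \<and> card e = 2)"

definition graph_iso :: "'v graph \<Rightarrow> 'w graph \<Rightarrow> bool" (infix "\<cong>\<^sub>g" 50) where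
  "\<Gamma> \<cong>\<^sub>g \<Delta> \<longleftrightarrow> (\<exists>f. bij_betw f (fst \<Gamma>) (fst \<Delta>) \<and>
     (\<forall>u\<in>fst \<Gamma>. \<forall>v\<in>fst \<Gamma>. {u, v} \<in> snd \<Gamma> \<longleftrightarrow> {f u, f v} \<in> snd \<Delta>))"

definition BCay :: "('a, 'b) monoid_scheme \<Rightarrow> 'a set \<Rightarrow> ('a \<times> nat) graph" where
  "BCay G S =
    (carrier G \<times> {1, 2},
     {{(g, 1), (s \<otimes>\<^bsub>G\<^esub> g, 2)} | g s. g \<in> carrier G \<and> s \<in> S})"

lemma simple_graph_BCay:
  assumes "group G" "finite (carrier G)" "S \<subseteq> carrier G"
  shows "simple_graph (BCay G S)"
proof -
  interpret group G by fact
  show ?thesis using assms(2,3) by (auto simp: simple_graph_def BCay_def)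
qed

text \<open>
  Being a BCI-graph depends on the pair of \<open>G\<close> and \<open>S\<close>, not only on the graph up to isomorphism.
  The set \<open>auto G\<close> consists of the automorphisms of \<open>G\<close> that are extensional on its carrier.
\<close>

definition BCI_graph :: "('a, 'b) monoid_scheme \<Rightarrow> 'a set \<Rightarrow> bool" where
  "BCI_graph G S \<longleftrightarrow>
    (\<forall>T. T \<subseteq> carrier G \<longrightarrow> BCay G S \<cong>\<^sub>g BCay G T \<longrightarrow>
      (\<exists>g\<in>carrier G. \<exists>\<alpha>\<in>auto G. T = g <#\<^bsub>G\<^esub> (\<alpha> ` S)))"

definition BCI_group :: "('a, 'b) monoid_scheme \<Rightarrow> bool" where
  "BCI_group G \<longleftrightarrow> (\<forall>S. S \<subseteq> carrier G \<longrightarrow> BCI_graph G S)"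

end

theory Submission
  imports Defs
begin

text \<open>
  Write \<open>S = A \<union> B b\<close> with \<open>A, B \<subseteq> \<int>\<^sub>n\<close>. Left translations and automorphisms act on the pairs
  \<open>(A, B)\<close> by \<open>(A, B) \<mapsto> (u A + s, u B + t)\<close> with \<open>u\<close> a unit, and by \<open>(A, B) \<mapsto> (B, A)\<close>. For
  \<open>n = 3, 5\<close> this leaves 10 and 24 classes of subsets, respectively, and for \<open>n = 2\<close> the additional
  automorphism \<open>a \<leftrightarrow> b\<close> brings their number down to 5. In each case the number of closed
  walks of length 6 in the bi-Cayley graph takes different values on different classes.

  Conversely, interchanging the two parts of the graph gives \<open>BCay G S \<cong> BCay G (S\<^sup>-\<^sup>1)\<close> for every \<open>S\<close>.
  For \<open>n \<ge> 6\<close> and \<open>A = B = {0, 1, 3}\<close> the sets \<open>S\<close> and \<open>S\<^sup>-\<^sup>1\<close> are inequivalent, because \<open>A\<close> is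
  not a translate of \<open>-A\<close>. For \<open>n = 4\<close> the sets \<open>{1, a\<^sup>2}\<close> and \<open>{1, b}\<close> both give disjoint unions of
  four-cycles, but \<open>b\<close> is not the image of the square \<open>a\<^sup>2\<close>.
\<close>

section \<open>Counting closed walks\<close>

text \<open>
  Every second vertex of a closed walk of length 6 gives a triple \<open>u, v, w\<close>, any two of which are
  joined through a common neighbour.
\<close>

definition codegree :: "'v graph \<Rightarrow> 'v \<Rightarrow> 'v \<Rightarrow> nat" where
  "codegree \<Gamma> u v = card {w \<in> fst \<Gamma>. {u, w} \<in> snd \<Gamma> \<and> {v, w} \<in> snd \<Gamma>}"

definition closed_walks6 :: "'v graph \<Rightarrow> nat" where
  "closed_walks6 \<Gamma> = (\<Sum>w\<in>fst \<Gamma>. \<Sum>v\<in>fst \<Gamma>. \<Sum>u\<in>fst \<Gamma>.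
     codegree \<Gamma> u v * codegree \<Gamma> v w * codegree \<Gamma> u w)"

lemma codegree_iso:
  assumes f: "bij_betw f (fst \<Gamma>) (fst \<Delta>)"
    and e: "\<forall>u\<in>fst \<Gamma>. \<forall>v\<in>fst \<Gamma>. {u, v} \<in> snd \<Gamma> \<longleftrightarrow> {f u, f v} \<in> snd \<Delta>"
    and uv: "u \<in> fst \<Gamma>" "v \<in> fst \<Gamma>"
  shows "codegree \<Delta> (f u) (f v) = codegree \<Gamma> u v"
proof -
  have "bij_betw f {w \<in> fst \<Gamma>. {u, w} \<in> snd \<Gamma> \<and> {v, w} \<in> snd \<Gamma>}
      {w \<in> fst \<Delta>. {f u, w} \<in> snd \<Delta> \<and> {f v, w} \<in> snd \<Delta>}"
    unfolding bij_betw_def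
  proof
    show "inj_on f {w \<in> fst \<Gamma>. {u, w} \<in> snd \<Gamma> \<and> {v, w} \<in> snd \<Gamma>}"
      using f by (auto simp: bij_betw_def inj_on_def)
    have "fst \<Delta> = f ` fst \<Gamma>" using f by (simp add: bij_betw_def)
    then show "f ` {w \<in> fst \<Gamma>. {u, w} \<in> snd \<Gamma> \<and> {v, w} \<in> snd \<Gamma>} =
        {w \<in> fst \<Delta>. {f u, w} \<in> snd \<Delta> \<and> {f v, w} \<in> snd \<Delta>}"
      using e uv by auto
  qed
  then show ?thesis unfolding codegree_def by (simp add: bij_betw_same_card)
qed

lemma closed_walks6_iso:
  assumes "\<Gamma> \<cong>\<^sub>g \<Delta>"
  shows "closed_walks6 \<Gamma> = closed_walks6 \<Delta>"
proof -
  obtain f where f: "bij_betw f (fst \<Gamma>) (fst \<Delta>)"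
    and e: "\<forall>u\<in>fst \<Gamma>. \<forall>v\<in>fst \<Gamma>. {u, v} \<in> snd \<Gamma> \<longleftrightarrow> {f u, f v} \<in> snd \<Delta>"
    using assms unfolding graph_iso_def by blast
  have "closed_walks6 \<Delta> = (\<Sum>w\<in>fst \<Gamma>. \<Sum>v\<in>fst \<Gamma>. \<Sum>u\<in>fst \<Gamma>.
     codegree \<Delta> (f u) (f v) * codegree \<Delta> (f v) (f w) * codegree \<Delta> (f u) (f w))"
    unfolding closed_walks6_def by (simp only: sum.reindex_bij_betw[OF f, symmetric])
  also have "\<dots> = closed_walks6 \<Gamma>"
    unfolding closed_walks6_def by (intro sum.cong refl) (simp add: codegree_iso[OF f e])
  finally show ?thesis by simp
qed

section \<open>Bi-Cayley graphs and affine equivalence of their connection sets\<close>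

context group
begin

text \<open>Edges are unordered, so either endpoint may lie in the first part; cancellation turns
  the existential over \<open>S\<close> into a test on one quotient.\<close>

lemma BCay_edge_iff:
  assumes "S \<subseteq> carrier G" "x \<in> carrier G" "y \<in> carrier G"
  shows "{(x, i), (y, j)} \<in> snd (BCay G S) \<longleftrightarrow>
    i = 1 \<and> j = 2 \<and> y \<otimes> inv x \<in> S \<or> i = 2 \<and> j = 1 \<and> x \<otimes> inv y \<in> S"
proof -
  have *: "(\<exists>s\<in>S. v = s \<otimes> u) \<longleftrightarrow> v \<otimes> inv u \<in> S" if "u \<in> carrier G" "v \<in> carrier G" for u v
  proof
    assume "\<exists>s\<in>S. v = s \<otimes> u"
    then show "v \<otimes> inv u \<in> S" using that assms(1) by (auto simp: m_assoc)
  next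
    assume "v \<otimes> inv u \<in> S"
    moreover have "v = v \<otimes> inv u \<otimes> u" using that by (simp add: m_assoc)
    ultimately show "\<exists>s\<in>S. v = s \<otimes> u" by blast
  qed
  have "{(x, i), (y, j)} \<in> snd (BCay G S) \<longleftrightarrow>
    i = 1 \<and> j = 2 \<and> (\<exists>s\<in>S. y = s \<otimes> x) \<or> i = 2 \<and> j = 1 \<and> (\<exists>s\<in>S. x = s \<otimes> y)"
    using assms by (auto simp: BCay_def doubleton_eq_iff)
  then show ?thesis using assms * by simp
qed

lemma fst_BCay: "fst (BCay G S) = carrier G \<times> {1, 2}"
  by (simp add: BCay_def)

text \<open>Covers only isomorphisms that keep both parts: \<open>\<phi>\<close> acts on the first,
  \<open>\<psi>\<close> on the second.\<close>

lemma BCay_isoI: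
  assumes S: "S \<subseteq> carrier G" and T: "T \<subseteq> carrier G"
    and \<phi>: "bij_betw \<phi> (carrier G) (carrier G)" and \<psi>: "bij_betw \<psi> (carrier G) (carrier G)"
    and e: "\<And>x y. x \<in> carrier G \<Longrightarrow> y \<in> carrier G \<Longrightarrow> y \<otimes> inv x \<in> S \<longleftrightarrow> \<psi> y \<otimes> inv (\<phi> x) \<in> T"
  shows "BCay G S \<cong>\<^sub>g BCay G T"
proof -
  let ?f = "\<lambda>(x, i::nat). (if i = 1 then \<phi> x else \<psi> x, i)"
  have c: "\<phi> x \<in> carrier G" "\<psi> x \<in> carrier G" if "x \<in> carrier G" for x
    using that \<phi> \<psi> by (auto simp: bij_betw_def)
  have "inj_on ?f (carrier G \<times> {1, 2})"
    using \<phi> \<psi> by (auto simp: bij_betw_def inj_on_def)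
  moreover have "?f ` (carrier G \<times> {1, 2}) = carrier G \<times> {1, 2}"
  proof -
    have "?f ` (carrier G \<times> {1, 2}) = (\<phi> ` carrier G) \<times> {1} \<union> (\<psi> ` carrier G) \<times> {2}"
      by (auto simp: image_iff)
    then show ?thesis using \<phi> \<psi> by (auto simp: bij_betw_def)
  qed
  ultimately have "bij_betw ?f (fst (BCay G S)) (fst (BCay G T))"
    by (simp add: bij_betw_def fst_BCay)
  moreover have "{u, v} \<in> snd (BCay G S) \<longleftrightarrow> {?f u, ?f v} \<in> snd (BCay G T)"
    if "u \<in> fst (BCay G S)" "v \<in> fst (BCay G S)" for u v
    using that e c by (auto simp: fst_BCay BCay_edge_iff[OF S] BCay_edge_iff[OF T])
  ultimately show ?thesis unfolding graph_iso_def by blast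
qed

lemma BCay_m_inv_iso:
  assumes S: "S \<subseteq> carrier G"
  shows "BCay G S \<cong>\<^sub>g BCay G (m_inv G ` S)"
proof -
  \<comment> \<open>Here \<open>3 - i\<close> exchanges the part labels 1 and 2.\<close>
  let ?f = "\<lambda>(x, i::nat). (x, 3 - i)"
  have T: "m_inv G ` S \<subseteq> carrier G" using S by auto
  have i: "y \<otimes> inv x \<in> m_inv G ` S \<longleftrightarrow> x \<otimes> inv y \<in> S" if "x \<in> carrier G" "y \<in> carrier G" for x y
  proof -
    have 1: "inv (x \<otimes> inv y) = y \<otimes> inv x" "inv (y \<otimes> inv x) = x \<otimes> inv y"
      using that by (simp_all add: inv_mult_group)
    show ?thesis
    proof
      assume "y \<otimes> inv x \<in> m_inv G ` S"
      then obtain s where s: "s \<in> S" "y \<otimes> inv x = inv s" by blast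
      then have "x \<otimes> inv y = s" using S 1(2) by auto
      then show "x \<otimes> inv y \<in> S" using s by simp
    next
      assume "x \<otimes> inv y \<in> S"
      then show "y \<otimes> inv x \<in> m_inv G ` S" unfolding 1(1)[symmetric] by (rule imageI)
    qed
  qed
  have "bij_betw ?f (fst (BCay G S)) (fst (BCay G (m_inv G ` S)))"
    unfolding fst_BCay by (rule bij_betwI[where g = ?f]) auto
  moreover have "{u, v} \<in> snd (BCay G S) \<longleftrightarrow> {?f u, ?f v} \<in> snd (BCay G (m_inv G ` S))"
    if "u \<in> fst (BCay G S)" "v \<in> fst (BCay G S)" for u v
    using that i by (auto simp: fst_BCay BCay_edge_iff[OF S] BCay_edge_iff[OF T])
  ultimately show ?thesis unfolding graph_iso_def by blast
qed

section \<open>Codegrees and closed walks in bi-Cayley graphs\<close>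

text \<open>In the group ring this is the coefficient of \<open>z\<close> in the product of
  \<open>inv S\<close> with \<open>S\<close>; \<open>left_corr\<close> belongs to the product of
  \<open>S\<close> with \<open>inv S\<close>.\<close>

definition right_corr :: "'a set \<Rightarrow> 'a \<Rightarrow> nat" where
  "right_corr S z = card {h \<in> S. h \<otimes> z \<in> S}"

definition left_corr :: "'a set \<Rightarrow> 'a \<Rightarrow> nat" where
  "left_corr S z = card {h \<in> S. z \<otimes> h \<in> S}"

text \<open>Right translations are automorphisms of the graph, so a codegree within one part depends
  only on the quotient \<open>z\<close> of the two vertices.\<close>

lemma codegree_BCay:
  assumes S: "S \<subseteq> carrier G" and x: "x \<in> carrier G" and z: "z \<in> carrier G"
  shows "codegree (BCay G S) (z \<otimes> x, 1) (x, 1) = right_corr S z"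
    and "codegree (BCay G S) (z \<otimes> x, 2) (x, 2) = left_corr S z"
proof -
  let ?V = "\<lambda>i. {w \<in> fst (BCay G S). {(z \<otimes> x, i), w} \<in> snd (BCay G S) \<and> {(x, i), w} \<in> snd (BCay G S)}"
  have zx: "z \<otimes> x \<in> carrier G" using x z by simp
  have sc: "s \<in> carrier G" if "s \<in> S" for s using that S by auto
  \<comment> \<open>A common neighbour has the form \<open>h z x\<close>: it is reached from
    \<open>z x\<close> through \<open>h\<close> and from \<open>x\<close> through
    \<open>h z\<close>.\<close>
  have "bij_betw (\<lambda>h. (h \<otimes> (z \<otimes> x), 2)) {h \<in> S. h \<otimes> z \<in> S} (?V 1)"
  proof (rule bij_betwI[where g = "\<lambda>w. fst w \<otimes> inv (z \<otimes> x)"])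
    show "(\<lambda>h. (h \<otimes> (z \<otimes> x), 2)) \<in> {h \<in> S. h \<otimes> z \<in> S} \<rightarrow> ?V 1"
    proof
      fix h assume h: "h \<in> {h \<in> S. h \<otimes> z \<in> S}"
      have "h \<otimes> (z \<otimes> x) \<otimes> inv (z \<otimes> x) = h" "h \<otimes> (z \<otimes> x) \<otimes> inv x = h \<otimes> z"
        using h x z sc[of h] by (simp_all add: m_assoc)
      then show "(h \<otimes> (z \<otimes> x), 2) \<in> ?V 1"
        using h x z zx sc[of h] by (auto simp: fst_BCay BCay_edge_iff[OF S])
    qed
    show "(\<lambda>w. fst w \<otimes> inv (z \<otimes> x)) \<in> ?V 1 \<rightarrow> {h \<in> S. h \<otimes> z \<in> S}"
    proof
      fix w assume w: "w \<in> ?V 1"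
      then obtain y where y: "w = (y, 2)" "y \<in> carrier G" "y \<otimes> inv (z \<otimes> x) \<in> S" "y \<otimes> inv x \<in> S"
        using x zx by (auto simp: fst_BCay BCay_edge_iff[OF S])
      have "y \<otimes> inv (z \<otimes> x) \<otimes> z = y \<otimes> inv x"
        using x z y(2) by (simp add: inv_mult_group m_assoc)
      then show "fst w \<otimes> inv (z \<otimes> x) \<in> {h \<in> S. h \<otimes> z \<in> S}" using y by simp
    qed
    show "fst (h \<otimes> (z \<otimes> x), 2) \<otimes> inv (z \<otimes> x) = h" if "h \<in> {h \<in> S. h \<otimes> z \<in> S}" for h
      using that zx sc[of h] by (simp add: m_assoc)
    show "(fst w \<otimes> inv (z \<otimes> x) \<otimes> (z \<otimes> x), 2) = w" if "w \<in> ?V 1" for w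
      using that x zx by (auto simp: fst_BCay BCay_edge_iff[OF S] m_assoc)
  qed
  then show "codegree (BCay G S) (z \<otimes> x, 1) (x, 1) = right_corr S z"
    unfolding codegree_def right_corr_def by (rule bij_betw_same_card[symmetric])
  \<comment> \<open>In the second part the common neighbour is \<open>inv h x\<close>:
    \<open>h\<close> leads from it to \<open>x\<close>, and \<open>z h\<close> leads to
    \<open>z x\<close>.\<close>
  have "bij_betw (\<lambda>h. (inv h \<otimes> x, 1)) {h \<in> S. z \<otimes> h \<in> S} (?V 2)"
  proof (rule bij_betwI[where g = "\<lambda>w. x \<otimes> inv (fst w)"])
    show "(\<lambda>h. (inv h \<otimes> x, 1)) \<in> {h \<in> S. z \<otimes> h \<in> S} \<rightarrow> ?V 2"
    proof
      fix h assume h: "h \<in> {h \<in> S. z \<otimes> h \<in> S}"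
      have "x \<otimes> inv (inv h \<otimes> x) = h" "z \<otimes> x \<otimes> inv (inv h \<otimes> x) = z \<otimes> h"
        using h x z sc[of h] by (simp_all add: m_assoc inv_mult_group) (simp_all add: m_assoc[symmetric])
      then show "(inv h \<otimes> x, 1) \<in> ?V 2"
        using h x z zx sc[of h] by (auto simp: fst_BCay BCay_edge_iff[OF S])
    qed
    show "(\<lambda>w. x \<otimes> inv (fst w)) \<in> ?V 2 \<rightarrow> {h \<in> S. z \<otimes> h \<in> S}"
      using x z zx by (auto simp: fst_BCay BCay_edge_iff[OF S] m_assoc)
    show "x \<otimes> inv (fst (inv h \<otimes> x, 1)) = h" if "h \<in> {h \<in> S. z \<otimes> h \<in> S}" for h
      using that x sc[of h] by (simp add: inv_mult_group m_assoc[symmetric])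
    show "(inv (x \<otimes> inv (fst w)) \<otimes> x, 1) = w" if "w \<in> ?V 2" for w
      using that x zx by (auto simp: fst_BCay BCay_edge_iff[OF S] m_assoc inv_mult_group)
  qed
  then show "codegree (BCay G S) (z \<otimes> x, 2) (x, 2) = left_corr S z"
    unfolding codegree_def left_corr_def by (rule bij_betw_same_card[symmetric])
qed

text \<open>The graph is bipartite: vertices in different parts have their neighbours in different
  parts.\<close>

lemma codegree_BCay_opposite:
  assumes S: "S \<subseteq> carrier G" and "x \<in> carrier G" "y \<in> carrier G"
  shows "codegree (BCay G S) (x, 1) (y, 2) = 0" "codegree (BCay G S) (x, 2) (y, 1) = 0"
proof -
  have "{w \<in> fst (BCay G S). {(x, 1), w} \<in> snd (BCay G S) \<and> {(y, 2), w} \<in> snd (BCay G S)} = {}"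
    "{w \<in> fst (BCay G S). {(x, 2), w} \<in> snd (BCay G S) \<and> {(y, 1), w} \<in> snd (BCay G S)} = {}"
    using assms(2,3) by (auto simp: fst_BCay BCay_edge_iff[OF S])
  then show "codegree (BCay G S) (x, 1) (y, 2) = 0" "codegree (BCay G S) (x, 2) (y, 1) = 0"
    by (simp_all only: codegree_def card.empty)
qed

lemma sum_carrier_mult_right:
  assumes "x \<in> carrier G"
  shows "(\<Sum>u\<in>carrier G. f u) = (\<Sum>p\<in>carrier G. f (p \<otimes> x))"
proof (rule sum.reindex_bij_witness[where i = "\<lambda>p. p \<otimes> x" and j = "\<lambda>u. u \<otimes> inv x"])
qed (use assms in \<open>auto simp: m_assoc\<close>)

text \<open>Substituting \<open>v = q w\<close> and \<open>u = p q w\<close> makes the summand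
  independent of \<open>w\<close>, so the outermost sum contributes the factor
  \<open>order G\<close>.\<close>

lemma sum_triangles_convolution:
  fixes F :: "'a \<Rightarrow> 'a \<Rightarrow> nat"
  assumes "\<And>x z. x \<in> carrier G \<Longrightarrow> z \<in> carrier G \<Longrightarrow> F (z \<otimes> x) x = c z"
  shows "(\<Sum>w\<in>carrier G. \<Sum>v\<in>carrier G. \<Sum>u\<in>carrier G. F u v * F v w * F u w) =
    order G * (\<Sum>q\<in>carrier G. \<Sum>p\<in>carrier G. c p * c q * c (p \<otimes> q))"
proof -
  have "(\<Sum>v\<in>carrier G. \<Sum>u\<in>carrier G. F u v * F v w * F u w) =
      (\<Sum>q\<in>carrier G. \<Sum>p\<in>carrier G. c p * c q * c (p \<otimes> q))" if w: "w \<in> carrier G" for w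
  proof -
    have "(\<Sum>v\<in>carrier G. \<Sum>u\<in>carrier G. F u v * F v w * F u w) =
        (\<Sum>v\<in>carrier G. \<Sum>p\<in>carrier G. F (p \<otimes> v) v * F v w * F (p \<otimes> v) w)"
      by (intro sum.cong refl sum_carrier_mult_right)
    also have "\<dots> = (\<Sum>q\<in>carrier G. \<Sum>p\<in>carrier G.
        F (p \<otimes> (q \<otimes> w)) (q \<otimes> w) * F (q \<otimes> w) w * F (p \<otimes> (q \<otimes> w)) w)"
      by (rule sum_carrier_mult_right[OF w])
    also have "\<dots> = (\<Sum>q\<in>carrier G. \<Sum>p\<in>carrier G. c p * c q * c (p \<otimes> q))"
    proof (intro sum.cong refl)
      fix p q assume "q \<in> carrier G" "p \<in> carrier G"
      then show "F (p \<otimes> (q \<otimes> w)) (q \<otimes> w) * F (q \<otimes> w) w * F (p \<otimes> (q \<otimes> w)) w =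
          c p * c q * c (p \<otimes> q)"
        using w assms[of "q \<otimes> w" p] assms[of w q] assms[of w "p \<otimes> q"] by (simp add: m_assoc)
    qed
    finally show ?thesis .
  qed
  then show ?thesis by (simp add: order_def)
qed

text \<open>Codegrees across the parts vanish, so only triples inside a single part contribute, and
  each part gives one convolution sum.\<close>

lemma closed_walks6_BCay:
  assumes fin: "finite (carrier G)" and S: "S \<subseteq> carrier G"
  shows "closed_walks6 (BCay G S) = order G *
    ((\<Sum>q\<in>carrier G. \<Sum>p\<in>carrier G. right_corr S p * right_corr S q * right_corr S (p \<otimes> q)) +
     (\<Sum>q\<in>carrier G. \<Sum>p\<in>carrier G. left_corr S p * left_corr S q * left_corr S (p \<otimes> q)))"
proof -
  let ?F = "codegree (BCay G S)"
  have split: "(\<Sum>u\<in>carrier G \<times> {1, 2}. f u) = (\<Sum>x\<in>carrier G. f (x, 1)) + (\<Sum>x\<in>carrier G. f (x, 2))"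
    for f :: "'a \<times> nat \<Rightarrow> nat"
  proof -
    have "(\<Sum>u\<in>carrier G \<times> {1, 2}. f u) = (\<Sum>x\<in>carrier G. \<Sum>i\<in>{1, 2}. f (x, i))"
      unfolding sum.cartesian_product by (rule sum.cong) auto
    then show ?thesis by (simp add: sum.distrib)
  qed
  have "closed_walks6 (BCay G S) =
      (\<Sum>w\<in>carrier G. \<Sum>v\<in>carrier G. \<Sum>u\<in>carrier G. ?F (u, 1) (v, 1) * ?F (v, 1) (w, 1) * ?F (u, 1) (w, 1)) +
      (\<Sum>w\<in>carrier G. \<Sum>v\<in>carrier G. \<Sum>u\<in>carrier G. ?F (u, 2) (v, 2) * ?F (v, 2) (w, 2) * ?F (u, 2) (w, 2))"
    unfolding closed_walks6_def fst_BCay split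
    using codegree_BCay_opposite[OF S] by simp
  also have "\<dots> = order G * (\<Sum>q\<in>carrier G. \<Sum>p\<in>carrier G. right_corr S p * right_corr S q * right_corr S (p \<otimes> q)) +
     order G * (\<Sum>q\<in>carrier G. \<Sum>p\<in>carrier G. left_corr S p * left_corr S q * left_corr S (p \<otimes> q))"
    using codegree_BCay[OF S] by (intro arg_cong2[where f = "(+)"] sum_triangles_convolution) auto
  finally show ?thesis by (simp add: distrib_left)
qed

section \<open>Affine equivalence of connection sets\<close>

text \<open>Using \<open>iso\<close> instead of the extensional maps in \<open>auto\<close> makes
  composites and inverses available directly; \<open>affine_equiv_auto_iff\<close> returns to the
  form in \<open>BCI_graph\<close>.\<close>

definition affine_equiv :: "'a set \<Rightarrow> 'a set \<Rightarrow> bool" where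
  "affine_equiv S T \<longleftrightarrow> (\<exists>g\<in>carrier G. \<exists>\<alpha>\<in>iso G G. T = g <# (\<alpha> ` S))"

lemma affine_equivI:
  "g \<in> carrier G \<Longrightarrow> \<alpha> \<in> iso G G \<Longrightarrow> T = g <# (\<alpha> ` S) \<Longrightarrow> affine_equiv S T"
  unfolding affine_equiv_def by blast

lemma affine_equiv_refl:
  assumes "S \<subseteq> carrier G"
  shows "affine_equiv S S"
proof (rule affine_equivI)
  show "S = \<one> <# ((\<lambda>x. x) ` S)" using assms by (auto simp: l_coset_def subset_iff)
qed (auto simp: iso_set_refl)

lemma affine_equiv_auto_iff:
  assumes S: "S \<subseteq> carrier G"
  shows "affine_equiv S T \<longleftrightarrow> (\<exists>g\<in>carrier G. \<exists>\<alpha>\<in>auto G. T = g <# (\<alpha> ` S))"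
proof
  assume "affine_equiv S T"
  then obtain g \<alpha> where g: "g \<in> carrier G" "\<alpha> \<in> iso G G" "T = g <# (\<alpha> ` S)"
    unfolding affine_equiv_def by blast
  have "restrict \<alpha> (carrier G) \<in> auto G"
    using g(2) by (auto simp: auto_def Bij_def iso_def hom_def Pi_def bij_betw_def inj_on_def)
  moreover have "restrict \<alpha> (carrier G) ` S = \<alpha> ` S" using S by auto
  ultimately show "\<exists>g\<in>carrier G. \<exists>\<alpha>\<in>auto G. T = g <# (\<alpha> ` S)" using g by metis
next
  assume "\<exists>g\<in>carrier G. \<exists>\<alpha>\<in>auto G. T = g <# (\<alpha> ` S)"
  then show "affine_equiv S T"
    unfolding affine_equiv_def by (auto simp: auto_def Bij_def iso_def)
qed

lemma affine_equiv_trans: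
  assumes S: "S \<subseteq> carrier G" and "affine_equiv S T" "affine_equiv T U"
  shows "affine_equiv S U"
proof -
  obtain g \<alpha> h \<beta> where g: "g \<in> carrier G" "\<alpha> \<in> iso G G" "T = g <# (\<alpha> ` S)"
    and h: "h \<in> carrier G" "\<beta> \<in> iso G G" "U = h <# (\<beta> ` T)"
    using assms(2,3) unfolding affine_equiv_def by blast
  have ac: "\<alpha> s \<in> carrier G" if "s \<in> S" for s
    using that S g(2) by (auto simp: iso_def hom_def)
  have bc: "\<beta> x \<in> carrier G" if "x \<in> carrier G" for x
    using that h(2) by (auto simp: iso_def hom_def)
  have bm: "\<beta> (x \<otimes> y) = \<beta> x \<otimes> \<beta> y" if "x \<in> carrier G" "y \<in> carrier G" for x y
    using that h(2) by (simp add: iso_def hom_def)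
  have "U = (\<lambda>s. h \<otimes> \<beta> (g \<otimes> \<alpha> s)) ` S"
    unfolding h(3) g(3) by (auto simp: l_coset_def image_image)
  also have "\<dots> = (\<lambda>s. (h \<otimes> \<beta> g) \<otimes> (\<beta> \<circ> \<alpha>) s) ` S"
    by (intro image_cong refl) (simp add: bm g h ac bc m_assoc)
  also have "\<dots> = (h \<otimes> \<beta> g) <# ((\<beta> \<circ> \<alpha>) ` S)"
    by (auto simp: l_coset_def image_image)
  finally show ?thesis
    by (rule affine_equivI[rotated 2]) (use g h bc iso_set_trans in auto)
qed

lemma affine_equiv_sym:
  assumes S: "S \<subseteq> carrier G" and "affine_equiv S T"
  shows "affine_equiv T S"
proof -
  obtain g \<alpha> where g: "g \<in> carrier G" "\<alpha> \<in> iso G G" "T = g <# (\<alpha> ` S)"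
    using assms(2) unfolding affine_equiv_def by blast
  let ?\<beta> = "inv_into (carrier G) \<alpha>"
  have b: "?\<beta> \<in> iso G G" using iso_set_sym[OF g(2)] .
  have ac: "\<alpha> s \<in> carrier G" if "s \<in> S" for s
    using that S g(2) by (auto simp: iso_def hom_def)
  have bc: "?\<beta> x \<in> carrier G" if "x \<in> carrier G" for x
    using that b by (auto simp: iso_def hom_def)
  have bm: "?\<beta> (x \<otimes> y) = ?\<beta> x \<otimes> ?\<beta> y" if "x \<in> carrier G" "y \<in> carrier G" for x y
    using that b by (simp add: iso_def hom_def)
  have ba: "?\<beta> (\<alpha> s) = s" if "s \<in> S" for s
    using that S g(2) by (auto simp: iso_def bij_betw_def)
  have "?\<beta> (inv g) <# (?\<beta> ` T) = (\<lambda>s. ?\<beta> (inv g) \<otimes> ?\<beta> (g \<otimes> \<alpha> s)) ` S"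
    unfolding g(3) by (auto simp: l_coset_def image_image)
  also have "\<dots> = (\<lambda>s. s) ` S"
  proof (intro image_cong refl)
    fix s assume s: "s \<in> S"
    have "?\<beta> (inv g) \<otimes> ?\<beta> (g \<otimes> \<alpha> s) = ?\<beta> (inv g \<otimes> (g \<otimes> \<alpha> s))"
      by (rule bm[symmetric]) (use s ac g in auto)
    also have "inv g \<otimes> (g \<otimes> \<alpha> s) = \<alpha> s" using s ac g by (simp add: m_assoc[symmetric])
    finally show "?\<beta> (inv g) \<otimes> ?\<beta> (g \<otimes> \<alpha> s) = s" using ba s by simp
  qed
  finally have "S = ?\<beta> (inv g) <# (?\<beta> ` T)" by simp
  then show ?thesis
    by (rule affine_equivI[rotated 2]) (use g b bc in auto)
qed

lemma affine_equiv_subset: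
  assumes "S \<subseteq> carrier G" "affine_equiv S T"
  shows "T \<subseteq> carrier G"
proof -
  obtain g \<alpha> where "g \<in> carrier G" "\<alpha> \<in> iso G G" "T = g <# (\<alpha> ` S)"
    using assms(2) unfolding affine_equiv_def by blast
  moreover have "\<alpha> ` S \<subseteq> carrier G" if "\<alpha> \<in> iso G G"
    using that assms(1) by (auto simp: iso_def bij_betw_def)
  ultimately show ?thesis by (simp add: l_coset_subset_G)
qed

text \<open>Let \<open>\<alpha>\<close> act on the first part and \<open>\<alpha>\<close> followed
  by left translation by \<open>g\<close> on the second. The quotient of the images of
  \<open>y\<close> and \<open>x\<close> is then \<open>g\<close> times the
  \<open>\<alpha>\<close>-image of their quotient.\<close>

lemma affine_equiv_BCay_iso:
  assumes S: "S \<subseteq> carrier G" and "affine_equiv S T"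
  shows "BCay G S \<cong>\<^sub>g BCay G T"
proof -
  obtain g \<alpha> where g: "g \<in> carrier G" "\<alpha> \<in> iso G G" "T = g <# (\<alpha> ` S)"
    using assms(2) unfolding affine_equiv_def by blast
  have h: "\<alpha> \<in> hom G G" and b: "bij_betw \<alpha> (carrier G) (carrier G)" using g(2) by (auto simp: iso_def)
  interpret \<alpha>: group_hom G G \<alpha> using h by unfold_locales
  have l: "bij_betw (\<lambda>x. g \<otimes> x) (carrier G) (carrier G)"
    by (rule bij_betwI[where g = "\<lambda>x. inv g \<otimes> x"]) (use g(1) in \<open>auto simp: m_assoc[symmetric]\<close>)
  show ?thesis
  proof (rule BCay_isoI[where \<phi> = \<alpha> and \<psi> = "\<lambda>x. g \<otimes> \<alpha> x"])
    show "T \<subseteq> carrier G" by (rule affine_equiv_subset[OF assms])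
    show "bij_betw (\<lambda>x. g \<otimes> \<alpha> x) (carrier G) (carrier G)"
      using bij_betw_trans[OF b l] by (simp add: o_def)
    fix x y assume xy: "x \<in> carrier G" "y \<in> carrier G"
    have "g \<otimes> \<alpha> y \<otimes> inv (\<alpha> x) = g \<otimes> \<alpha> (y \<otimes> inv x)"
      using xy g(1) by (simp add: m_assoc)
    moreover have z: "g \<otimes> \<alpha> z \<in> T \<longleftrightarrow> z \<in> S" if z: "z \<in> carrier G" for z
    proof -
      have "g \<otimes> \<alpha> z \<in> T \<longleftrightarrow> (\<exists>s\<in>S. g \<otimes> \<alpha> z = g \<otimes> \<alpha> s)"
        unfolding g(3) by (auto simp: l_coset_def)
      also have "\<dots> \<longleftrightarrow> (\<exists>s\<in>S. \<alpha> z = \<alpha> s)"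
        using z S g(1) by (intro bex_cong refl) auto
      also have "\<dots> \<longleftrightarrow> z \<in> S"
        using z S b by (auto simp: bij_betw_def dest: inj_onD)
      finally show ?thesis .
    qed
    ultimately show "y \<otimes> inv x \<in> S \<longleftrightarrow> g \<otimes> \<alpha> y \<otimes> inv (\<alpha> x) \<in> T"
      using z[OF m_closed[OF xy(2) inv_closed[OF xy(1)]]] by (simp only:)
  qed (use S b in auto)
qed

text \<open>The walk count is constant on affine classes and invariant under graph isomorphism. If
  it separates the representatives, isomorphic graphs have connection sets with the same
  representative.\<close>

lemma BCI_groupI_invariant:
  assumes rep: "\<And>S. S \<subseteq> carrier G \<Longrightarrow> \<exists>R\<in>\<R>. affine_equiv S R"
    and inj: "inj_on (\<lambda>R. closed_walks6 (BCay G R)) \<R>"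
  shows "BCI_group G"
  unfolding BCI_group_def BCI_graph_def
proof (intro allI impI)
  fix S T assume S: "S \<subseteq> carrier G" and T: "T \<subseteq> carrier G" and iso: "BCay G S \<cong>\<^sub>g BCay G T"
  obtain R where R: "R \<in> \<R>" "affine_equiv S R" using rep[OF S] by blast
  obtain Q where Q: "Q \<in> \<R>" "affine_equiv T Q" using rep[OF T] by blast
  have "closed_walks6 (BCay G R) = closed_walks6 (BCay G Q)"
    using closed_walks6_iso[OF iso] closed_walks6_iso[OF affine_equiv_BCay_iso[OF S R(2)]]
      closed_walks6_iso[OF affine_equiv_BCay_iso[OF T Q(2)]] by simp
  then have "R = Q" using inj R(1) Q(1) by (auto dest: inj_onD)
  then have "affine_equiv S T"
    using affine_equiv_trans[OF S R(2)] affine_equiv_sym[OF T Q(2)] by simp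
  then show "\<exists>g\<in>carrier G. \<exists>\<alpha>\<in>auto G. T = g <# (\<alpha> ` S)"
    using affine_equiv_auto_iff[OF S] by simp
qed

end

section \<open>Subsets of dihedral groups\<close>

lemma carrier_dihedral_group: "carrier (dihedral_group n) = {0..<int n} \<times> UNIV"
  by (simp add: dihedral_group_def)

lemma mult_dihedral_group:
  "(i, r) \<otimes>\<^bsub>dihedral_group n\<^esub> (j, s) = ((if r then i - j else i + j) mod int n, r \<noteq> s)"
  by (simp add: dihedral_group_def)

definition dihedral_set :: "int set \<Rightarrow> int set \<Rightarrow> (int \<times> bool) set" where
  "dihedral_set A B = A \<times> {False} \<union> B \<times> {True}"

lemma mod_affine_inj_on:
  assumes "coprime u (int n)"
  shows "inj_on (\<lambda>i. (u * i + s) mod int n) {0..<int n}"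
proof
  fix i j assume ij: "i \<in> {0..<int n}" "j \<in> {0..<int n}"
    and "(u * i + s) mod int n = (u * j + s) mod int n"
  then have "int n dvd u * i + s - (u * j + s)" by (simp add: mod_eq_dvd_iff)
  also have "u * i + s - (u * j + s) = u * (i - j)" by (simp add: algebra_simps)
  finally have "int n dvd i - j"
    using assms by (simp add: coprime_dvd_mult_right_iff coprime_commute)
  then show "i = j" using ij by (auto dest!: zdvd_imp_le[rotated] simp: mod_eq_dvd_iff[symmetric])
qed

text \<open>This is the automorphism sending \<open>a\<close> to \<open>a^u\<close> and
  \<open>b\<close> to \<open>a^v b\<close>.\<close>

lemma dihedral_affine_iso:
  assumes n: "n \<ge> 1" and u: "coprime u (int n)"
  shows "(\<lambda>(i, r). ((u * i + (if r then v else 0)) mod int n, r)) \<in> iso (dihedral_group n) (dihedral_group n)"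
    (is "?\<alpha> \<in> _")
proof -
  have lin: "(u * (k mod int n) + w) mod int n = (u * k + w) mod int n" for k w
    by (metis mod_add_left_eq mod_mult_right_eq)
  have into: "?\<alpha> ` carrier (dihedral_group n) \<subseteq> carrier (dihedral_group n)"
    using n by (auto simp: carrier_dihedral_group)
  have inj: "inj_on ?\<alpha> (carrier (dihedral_group n))"
  proof
    fix x y
    assume xy: "x \<in> carrier (dihedral_group n)" "y \<in> carrier (dihedral_group n)" "?\<alpha> x = ?\<alpha> y"
    then show "x = y"
      using inj_onD[OF mod_affine_inj_on[OF u, of "if snd x then v else 0"], of "fst x" "fst y"]
      by (auto simp: carrier_dihedral_group split: prod.splits)
  qed
  have "bij_betw ?\<alpha> (carrier (dihedral_group n)) (carrier (dihedral_group n))"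
    by (rule bij_betw_imageI[OF inj endo_inj_surj[OF finite_dihedral_group into inj]])
  moreover have "?\<alpha> \<in> hom (dihedral_group n) (dihedral_group n)"
  proof (rule homI)
    fix x y :: "int \<times> bool"
    obtain i r j s where "x = (i, r)" "y = (j, s)" by (cases x, cases y)
    then show "?\<alpha> (x \<otimes>\<^bsub>dihedral_group n\<^esub> y) = ?\<alpha> x \<otimes>\<^bsub>dihedral_group n\<^esub> ?\<alpha> y"
      by (cases r; cases s) (simp_all add: mult_dihedral_group mod_simps lin, simp_all add: algebra_simps)
  qed (use into in blast)
  ultimately show ?thesis by (simp add: iso_def)
qed

lemma affine_equiv_dihedral_set:
  assumes n: "n \<ge> 1" and u: "coprime u (int n)"
  shows "group.affine_equiv (dihedral_group n) (dihedral_set A B)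
    (dihedral_set ((\<lambda>i. (u * i + s) mod int n) ` A) ((\<lambda>i. (u * i + t) mod int n) ` B))"
proof -
  interpret group "dihedral_group n" by (rule group_dihedral_group[OF n])
  show ?thesis
  \<comment> \<open>Left translation by \<open>a^s\<close> shifts both components by
    \<open>s\<close>; the automorphism shifts the second by a further \<open>t - s\<close>. The two
    shifts are thus independent.\<close>
  proof (rule affine_equivI[OF _ dihedral_affine_iso[OF n u, of "t - s"]])
    show "(s mod int n, False) \<in> carrier (dihedral_group n)"
      using n by (simp add: carrier_dihedral_group)
    have "(s + (u * i + (t - s))) mod int n = (u * i + t) mod int n" for i
      by (simp add: algebra_simps)
    then show "dihedral_set ((\<lambda>i. (u * i + s) mod int n) ` A) ((\<lambda>i. (u * i + t) mod int n) ` B) =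
        (s mod int n, False) <#\<^bsub>dihedral_group n\<^esub>
          ((\<lambda>(i, r). ((u * i + (if r then t - s else 0)) mod int n, r)) ` dihedral_set A B)"
      by (auto simp: dihedral_set_def l_coset_def image_Un mult_dihedral_group mod_simps
          image_iff add.commute)
  qed
qed

text \<open>Left translation by \<open>b\<close> exchanges rotations and reflections but negates
  exponents; the automorphism with multiplier \<open>- 1\<close> undoes the sign.\<close>

lemma affine_equiv_dihedral_set_swap:
  assumes n: "n \<ge> 1" and AB: "A \<subseteq> {0..<int n}" "B \<subseteq> {0..<int n}"
  shows "group.affine_equiv (dihedral_group n) (dihedral_set A B) (dihedral_set B A)"
proof -
  interpret group "dihedral_group n" by (rule group_dihedral_group[OF n])
  have u: "coprime (- 1) (int n)" by simp
  show ?thesis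
  proof (rule affine_equivI[OF _ dihedral_affine_iso[OF n u, of 0]])
    show "(0, True) \<in> carrier (dihedral_group n)"
      using n by (simp add: carrier_dihedral_group)
    have "i mod int n = i" if "i \<in> A \<union> B" for i using that AB by auto
    then show "dihedral_set B A = (0, True) <#\<^bsub>dihedral_group n\<^esub>
          ((\<lambda>(i, r). ((- 1 * i + (if r then 0 else 0)) mod int n, r)) ` dihedral_set A B)"
      by (auto simp: dihedral_set_def l_coset_def image_Un mult_dihedral_group mod_simps
          image_iff)
  qed
qed

section \<open>Executable counts of closed walks\<close>

text \<open>
  The weights are integers because \<open>code_simp\<close> hardly terminates on products of natural numbers of
  this size.
\<close>

definition dihedral_mult :: "nat \<Rightarrow> int \<times> bool \<Rightarrow> int \<times> bool \<Rightarrow> int \<times> bool" where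
  "dihedral_mult n = (\<lambda>(i, r) (j, s). ((if r then i - j else i + j) mod int n, r \<noteq> s))"

text \<open>Tabulating the correlations means each is computed once and afterwards only looked up.
  Flipping the arguments of \<open>f\<close> yields left instead of right correlations.\<close>

definition corr_table :: "('a \<Rightarrow> 'a \<Rightarrow> 'a) \<Rightarrow> 'a list \<Rightarrow> 'a list \<Rightarrow> ('a \<times> int) list" where
  "corr_table f G xs = map (\<lambda>z. (z, \<Sum>h\<leftarrow>xs. if f h z \<in> set xs then 1 else 0)) G"

definition triangle_sum :: "('a \<Rightarrow> 'a \<Rightarrow> 'a) \<Rightarrow> ('a \<times> int) list \<Rightarrow> int" where
  "triangle_sum f cs = (\<Sum>(q, l)\<leftarrow>cs. \<Sum>(p, k)\<leftarrow>cs. k * l * the (map_of cs (f p q)))"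

definition dihedral_walks :: "nat \<Rightarrow> int list \<times> int list \<Rightarrow> int" where
  "dihedral_walks n = (\<lambda>(A, B).
     let f = dihedral_mult n; G = List.product [0..int n - 1] [False, True];
       xs = map (\<lambda>i. (i, False)) A @ map (\<lambda>i. (i, True)) B
     in triangle_sum f (corr_table f G xs) + triangle_sum f (corr_table (\<lambda>h z. f z h) G xs))"

text \<open>Closure of \<open>G\<close> under \<open>f\<close> makes every lookup succeed;
  distinctness turns the list sums into sums over sets.\<close>

lemma triangle_sum_corr_table:
  assumes G: "distinct G" and xs: "distinct xs"
    and cl: "\<forall>p\<in>set G. \<forall>q\<in>set G. f p q \<in> set G"
  shows "triangle_sum f (corr_table g G xs) = (\<Sum>q\<in>set G. \<Sum>p\<in>set G.
    int (card {h \<in> set xs. g h p \<in> set xs}) * int (card {h \<in> set xs. g h q \<in> set xs}) *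
    int (card {h \<in> set xs. g h (f p q) \<in> set xs}))"
proof -
  define c where "c z = int (card {h \<in> set xs. g h z \<in> set xs})" for z
  have "(\<Sum>h\<leftarrow>xs. if g h z \<in> set xs then 1 else 0) = c z" for z
    using xs by (simp add: sum_list_distinct_conv_sum_set sum.If_cases c_def Int_def)
  then have t: "corr_table g G xs = map (\<lambda>z. (z, c z)) G" by (simp add: corr_table_def)
  have look: "the (map_of (map (\<lambda>z. (z, c z)) G) z) = c z" if "z \<in> set G" for z
    using that by (simp add: map_of_map_restrict)
  show ?thesis
    unfolding triangle_sum_def t c_def[symmetric] using G cl
    by (simp add: o_def sum_list_distinct_conv_sum_set look cong: sum.cong)
qed

lemma closed_walks6_dihedral_set:
  assumes n: "n \<ge> 1" and d: "distinct A" "distinct B"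
    and AB: "set A \<subseteq> {0..<int n}" "set B \<subseteq> {0..<int n}"
  shows "int (closed_walks6 (BCay (dihedral_group n) (dihedral_set (set A) (set B)))) =
    2 * int n * dihedral_walks n (A, B)"
proof -
  interpret group "dihedral_group n" by (rule group_dihedral_group[OF n])
  let ?xs = "map (\<lambda>i. (i, False)) A @ map (\<lambda>i. (i, True)) B"
  let ?G = "List.product [0..int n - 1] [False, True]"
  have S: "dihedral_set (set A) (set B) = set ?xs" by (auto simp: dihedral_set_def)
  have xs: "distinct ?xs" using d by (auto simp: distinct_map inj_on_def)
  have G: "distinct ?G" "set ?G = carrier (dihedral_group n)"
    by (auto simp: distinct_product carrier_dihedral_group)
  have m: "monoid.mult (dihedral_group n) = dihedral_mult n"
    by (simp add: dihedral_group_def dihedral_mult_def)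
  have sub: "set ?xs \<subseteq> carrier (dihedral_group n)"
    using AB by (auto simp: carrier_dihedral_group)
  have cl: "\<forall>p\<in>set ?G. \<forall>q\<in>set ?G. dihedral_mult n p q \<in> set ?G"
    using m_closed unfolding G(2) m by blast
  note tri = triangle_sum_corr_table[OF G(1) xs cl, of "dihedral_mult n"]
    triangle_sum_corr_table[OF G(1) xs cl, of "\<lambda>h z. dihedral_mult n z h"]
  show ?thesis
    unfolding S closed_walks6_BCay[OF finite_dihedral_group sub] order_dihedral_group
    by (simp only: dihedral_walks_def Let_def prod.case tri G(2) right_corr_def left_corr_def m
        of_nat_mult of_nat_add of_nat_sum of_nat_numeral)
qed

section \<open>Representatives up to affine equivalence\<close>

lemma dihedral_set_cover:
  assumes "S \<subseteq> carrier (dihedral_group n)"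
  obtains A B where "A \<subseteq> {0..<int n}" "B \<subseteq> {0..<int n}" "S = dihedral_set A B"
proof
  show "{i. (i, False) \<in> S} \<subseteq> {0..<int n}" "{i. (i, True) \<in> S} \<subseteq> {0..<int n}"
    using assms by (auto simp: carrier_dihedral_group)
  show "S = dihedral_set {i. (i, False) \<in> S} {i. (i, True) \<in> S}"
  proof (rule Set.set_eqI)
    fix x show "x \<in> S \<longleftrightarrow> x \<in> dihedral_set {i. (i, False) \<in> S} {i. (i, True) \<in> S}"
      by (cases x, cases "snd x") (auto simp: dihedral_set_def)
  qed
qed

definition dilates :: "int \<Rightarrow> int \<Rightarrow> int list \<Rightarrow> int list \<Rightarrow> bool" where
  "dilates n u A B \<longleftrightarrow> (\<exists>s\<in>set [0..n - 1]. set (map (\<lambda>i. (u * i + s) mod n) A) = set B)"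

definition translates_into :: "int \<Rightarrow> int list list \<Rightarrow> int list \<Rightarrow> bool" where
  "translates_into n L A \<longleftrightarrow> (\<exists>C\<in>set L. dilates n 1 A C)"

text \<open>Both components can be shifted independently, so each may be replaced by a translation
  representative from \<open>L\<close>. Since \<open>subseqs\<close> lists all subsets, the
  condition on \<open>L\<close> is a finite check.\<close>

lemma affine_equiv_translates:
  assumes n: "n \<ge> 1" and L: "\<forall>A\<in>set (subseqs [0..int n - 1]). translates_into (int n) L A"
    and A: "A \<subseteq> {0..<int n}" and B: "B \<subseteq> {0..<int n}"
  shows "\<exists>C\<in>set L. \<exists>D\<in>set L.
    group.affine_equiv (dihedral_group n) (dihedral_set A B) (dihedral_set (set C) (set D))"
proof -
  have *: "\<exists>s. \<exists>C\<in>set L. (\<lambda>i. (1 * i + s) mod int n) ` A = set C" if A: "A \<subseteq> {0..<int n}" for A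
  proof -
    have "A \<in> Pow (set [0..int n - 1])" using A by auto
    then obtain xs where "A = set xs" "xs \<in> set (subseqs [0..int n - 1])"
      unfolding subseqs_powset[symmetric] by blast
    then show ?thesis using L unfolding translates_into_def dilates_def set_map by blast
  qed
  obtain s C where C: "C \<in> set L" "(\<lambda>i. (1 * i + s) mod int n) ` A = set C" using *[OF A] by blast
  obtain t D where D: "D \<in> set L" "(\<lambda>i. (1 * i + t) mod int n) ` B = set D" using *[OF B] by blast
  show ?thesis
    using affine_equiv_dihedral_set[OF n, of 1 A B s t] C D by auto
qed

text \<open>The reduction from \<open>L\<close> times \<open>L\<close> to \<open>R\<close> stays a
  hypothesis because \<open>n = 2\<close> has an automorphism outside the affine family. Walk counts
  are compared after cancelling the factor \<open>2 n\<close>.\<close>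

lemma BCI_dihedral_groupI:
  assumes n: "n \<ge> 1"
    and dist: "\<forall>A\<in>set L. distinct A \<and> set A \<subseteq> set [0..int n - 1]"
    and R: "set R \<subseteq> set (List.product L L)"
    and walks: "distinct (map (dihedral_walks n) R)"
    and L: "\<forall>A\<in>set (subseqs [0..int n - 1]). translates_into (int n) L A"
    and rep: "\<And>A B. A \<in> set L \<Longrightarrow> B \<in> set L \<Longrightarrow> \<exists>(C, D)\<in>set R.
      group.affine_equiv (dihedral_group n) (dihedral_set (set A) (set B)) (dihedral_set (set C) (set D))"
  shows "BCI_group (dihedral_group n)"
proof -
  interpret group "dihedral_group n" by (rule group_dihedral_group[OF n])
  let ?\<R> = "(\<lambda>(A, B). dihedral_set (set A) (set B)) ` set R"
  have up: "set [0..int n - 1] = {0..<int n}" by auto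
  have w: "int (closed_walks6 (BCay (dihedral_group n) (dihedral_set (set A) (set B)))) =
      2 * int n * dihedral_walks n (A, B)" if "(A, B) \<in> set R" for A B
    using that R dist unfolding up by (intro closed_walks6_dihedral_set[OF n]) auto
  show ?thesis
  proof (rule BCI_groupI_invariant[where \<R> = ?\<R>])
    fix S assume S: "S \<subseteq> carrier (dihedral_group n)"
    then obtain A B where "A \<subseteq> {0..<int n}" "B \<subseteq> {0..<int n}" "S = dihedral_set A B"
      by (rule dihedral_set_cover)
    then obtain C D where CD: "C \<in> set L" "D \<in> set L" "affine_equiv S (dihedral_set (set C) (set D))"
      using affine_equiv_translates[OF n L] by blast
    then obtain E F where "(E, F) \<in> set R"
      "affine_equiv (dihedral_set (set C) (set D)) (dihedral_set (set E) (set F))"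
      using rep by blast
    then show "\<exists>R\<in>?\<R>. affine_equiv S R"
      using affine_equiv_trans[OF S CD(3)] by (intro bexI[of _ "dihedral_set (set E) (set F)"]) auto
  next
    show "inj_on (\<lambda>S. closed_walks6 (BCay (dihedral_group n) S)) ?\<R>"
    proof (rule inj_onI, clarsimp)
      fix A B C D
      assume AB: "(A, B) \<in> set R" and CD: "(C, D) \<in> set R"
        and eq: "closed_walks6 (BCay (dihedral_group n) (dihedral_set (set A) (set B))) =
          closed_walks6 (BCay (dihedral_group n) (dihedral_set (set C) (set D)))"
      have "dihedral_walks n (A, B) = dihedral_walks n (C, D)"
        using w[OF AB] w[OF CD] n unfolding eq by simp
      then have "(A, B) = (C, D)"
        using walks AB CD by (auto simp: distinct_map dest: inj_onD)
      then show "dihedral_set (set A) (set B) = dihedral_set (set C) (set D)" by simp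
    qed
  qed
qed

text \<open>A computable sufficient condition for the reduction to \<open>R\<close>: identity, swap,
  or dilation by the single unit \<open>u\<close> with or without a swap.\<close>

definition reducible :: "int \<Rightarrow> int \<Rightarrow> int list list \<Rightarrow> (int list \<times> int list) list \<Rightarrow> bool" where
  "reducible n u L R \<longleftrightarrow> (\<forall>A\<in>set L. \<forall>B\<in>set L. (A, B) \<in> set R \<or> (B, A) \<in> set R \<or>
     (\<exists>(C, D)\<in>set R. dilates n u A C \<and> dilates n u B D \<or> dilates n u A D \<and> dilates n u B C))"

lemma BCI_dihedral_group_reducible:
  assumes n: "n \<ge> 1" and u: "coprime u (int n)"
    and dist: "\<forall>A\<in>set L. distinct A \<and> set A \<subseteq> set [0..int n - 1]"
    and R: "set R \<subseteq> set (List.product L L)"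
    and walks: "distinct (map (dihedral_walks n) R)"
    and L: "\<forall>A\<in>set (subseqs [0..int n - 1]). translates_into (int n) L A"
    and LR: "reducible (int n) u L R"
  shows "BCI_group (dihedral_group n)"
proof (rule BCI_dihedral_groupI[OF n dist R walks L])
  interpret group "dihedral_group n" by (rule group_dihedral_group[OF n])
  let ?e = "\<lambda>A B C D. affine_equiv (dihedral_set (set A) (set B)) (dihedral_set (set C) (set D))"
  have dil: "?e A B C D" if "dilates (int n) u A C" "dilates (int n) u B D" for A B C D
    using affine_equiv_dihedral_set[OF n u, of "set A" "set B"] that
    unfolding dilates_def set_map by metis
  have up: "set [0..int n - 1] = {0..<int n}" by auto
  fix A B assume AB: "A \<in> set L" "B \<in> set L"
  have sub: "set A \<subseteq> {0..<int n}" "set B \<subseteq> {0..<int n}"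
    using AB dist unfolding up by auto
  have subG: "dihedral_set (set A) (set B) \<subseteq> carrier (dihedral_group n)"
    using sub by (auto simp: dihedral_set_def carrier_dihedral_group)
  have swap: "?e A B B A" by (rule affine_equiv_dihedral_set_swap[OF n sub])
  have "(A, B) \<in> set R \<or> (B, A) \<in> set R \<or>
     (\<exists>(C, D)\<in>set R. dilates n u A C \<and> dilates n u B D \<or> dilates n u A D \<and> dilates n u B C)"
    using LR AB unfolding reducible_def by blast
  then consider "(A, B) \<in> set R" | "(B, A) \<in> set R"
    | C D where "(C, D) \<in> set R" "dilates n u A C" "dilates n u B D"
    | C D where "(C, D) \<in> set R" "dilates n u A D" "dilates n u B C" by blast
  then show "\<exists>(C, D)\<in>set R. ?e A B C D"
  proof cases
    case 1
    then show ?thesis using affine_equiv_refl[OF subG] by blast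
  next
    case 2
    then show ?thesis using swap by blast
  next
    case 3
    then show ?thesis using dil by blast
  next
    case 4
    then show ?thesis using affine_equiv_trans[OF subG swap dil] by blast
  qed
qed

section \<open>The cases n = 2, 3, 5\<close>

lemma BCI_dihedral_group_2: "BCI_group (dihedral_group 2)"
proof -
  define L :: "int list list" where "L = [[], [0], [0, 1]]"
  define R :: "(int list \<times> int list) list"
    \<comment> \<open>One pair for each cardinality from 0 to 4.\<close>
    where "R = [([], []), ([0], []), ([0, 1], []), ([0, 1], [0]), ([0, 1], [0, 1])]"
  interpret group "dihedral_group 2" by (rule group_dihedral_group) simp
  have up: "set [0..int 2 - 1] = {0..<int 2}" by auto
  have dist: "\<forall>A\<in>set L. distinct A \<and> set A \<subseteq> set [0..int 2 - 1]"
    unfolding L_def by code_simp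
  show ?thesis
  proof (rule BCI_dihedral_groupI[where L = L and R = R, OF _ dist])
    show "set R \<subseteq> set (List.product L L)"
      unfolding R_def L_def by code_simp
    show "distinct (map (dihedral_walks 2) R)"
      unfolding R_def by code_simp
    show "\<forall>A\<in>set (subseqs [0..int 2 - 1]). translates_into (int 2) L A"
      unfolding L_def by code_simp
    fix A B assume AB: "A \<in> set L" "B \<in> set L"
    have sub: "set A \<subseteq> {0..<int 2}" "set B \<subseteq> {0..<int 2}"
      using AB dist unfolding up by auto
    then have subG: "dihedral_set (set A) (set B) \<subseteq> carrier (dihedral_group 2)"
      by (auto simp: dihedral_set_def carrier_dihedral_group)
    consider "(A, B) \<in> set R" | "(B, A) \<in> set R" | "A = [0]" "B = [0]"
      using AB unfolding L_def R_def by auto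
    then show "\<exists>(C, D)\<in>set R. affine_equiv (dihedral_set (set A) (set B)) (dihedral_set (set C) (set D))"
    proof cases
      case 1
      then show ?thesis using affine_equiv_refl[OF subG] by blast
    next
      case 2
      then show ?thesis using affine_equiv_dihedral_set_swap[OF _ sub] by fastforce
    next
      case 3
      \<comment> \<open>The exchange of \<open>a\<close> and \<open>b\<close> in the Klein
        four-group; it carries \<open>{1, b}\<close> to \<open>{1, a}\<close>.\<close>
      let ?\<alpha> = "\<lambda>(i, r). (of_bool r, i = 1) :: int \<times> bool"
      have c: "carrier (dihedral_group 2) = {(0, False), (0, True), (1, False), (1, True)}"
        by (auto simp: carrier_dihedral_group)
      have "?\<alpha> \<in> hom (dihedral_group 2) (dihedral_group 2)"
        by (rule homI) (auto simp: c mult_dihedral_group)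
      moreover have "bij_betw ?\<alpha> (carrier (dihedral_group 2)) (carrier (dihedral_group 2))"
        by (auto simp: c bij_betw_def inj_on_def image_iff)
      ultimately have \<alpha>: "?\<alpha> \<in> iso (dihedral_group 2) (dihedral_group 2)" by (simp add: iso_def)
      have "affine_equiv (dihedral_set {0} {0}) (dihedral_set {0, 1} {})"
      proof (rule affine_equivI[OF _ \<alpha>])
        show "dihedral_set {0, 1} {} = (0, False) <#\<^bsub>dihedral_group 2\<^esub> (?\<alpha> ` dihedral_set {0} {0})"
          by (auto simp: dihedral_set_def l_coset_def mult_dihedral_group image_iff)
      qed (simp add: c)
      then show ?thesis by (auto simp: 3 R_def)
    qed
  qed simp
qed

lemma BCI_dihedral_group_3: "BCI_group (dihedral_group 3)"
proof -
  define L :: "int list list" where "L = [[], [0], [0, 1], [0, 1, 2]]"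
  \<comment> \<open>Subsets of equal size modulo 3 are translates of each other, so only the two
    sizes matter, and the swap orders them.\<close>
  define R where "R = [(A, B). A \<leftarrow> L, B \<leftarrow> L, length B \<le> length A]"
  show ?thesis
  proof (rule BCI_dihedral_group_reducible[where L = L and R = R and u = 1])
    show "\<forall>A\<in>set L. distinct A \<and> set A \<subseteq> set [0..int 3 - 1]"
      unfolding L_def by code_simp
    show "set R \<subseteq> set (List.product L L)"
      unfolding R_def L_def by code_simp
    show "distinct (map (dihedral_walks 3) R)"
      unfolding R_def L_def by code_simp
    show "\<forall>A\<in>set (subseqs [0..int 3 - 1]). translates_into (int 3) L A"
      unfolding L_def by code_simp
    show "reducible (int 3) 1 L R"
      unfolding R_def L_def by code_simp
  qed simp_all
qed

lemma BCI_dihedral_group_5: "BCI_group (dihedral_group 5)"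
proof -
  \<comment> \<open>The intervals modulo 5. Up to translation, doubling exchanges
    \<open>{0, 1}\<close> with \<open>{0, 2}\<close> and \<open>{0, 1, 2}\<close> with
    \<open>{0, 2, 4}\<close>, and fixes the other classes.\<close>
  define I :: "int list list" where "I = [[], [0], [0, 1], [0, 1, 2], [0, 1, 2, 3], [0, 1, 2, 3, 4]]"
  define L where "L = I @ [[0, 2], [0, 2, 4]]"
  \<comment> \<open>Swapping puts the larger component first, and doubling makes it an interval. If
    it has at least 4 elements, its class is fixed by doubling, so the other component can be made
    an interval too.\<close>
  define R where "R = [(A, B). A \<leftarrow> I, B \<leftarrow> L, length B \<le> length A \<and> (B \<in> set I \<or> length A \<le> 3)]"
  show ?thesis
  proof (rule BCI_dihedral_group_reducible[where L = L and R = R and u = 2])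
    show "\<forall>A\<in>set L. distinct A \<and> set A \<subseteq> set [0..int 5 - 1]"
      unfolding L_def I_def by code_simp
    show "set R \<subseteq> set (List.product L L)"
      unfolding R_def L_def I_def by code_simp
    show "distinct (map (dihedral_walks 5) R)"
      unfolding R_def L_def I_def by code_simp
    show "\<forall>A\<in>set (subseqs [0..int 5 - 1]). translates_into (int 5) L A"
      unfolding L_def I_def by code_simp
    show "reducible (int 5) 2 L R"
      unfolding R_def L_def I_def by code_simp
  qed simp_all
qed

section \<open>The remaining cases\<close>

text \<open>
  The set \<open>S = {1, a, a\<^sup>3}{1, b}\<close> satisfies \<open>S b = S\<close>. If \<open>S\<^sup>-\<^sup>1 = g S\<^sup>\<alpha>\<close> then \<open>S\<^sup>-\<^sup>1\<close> is fixed by right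
  multiplication with the nontrivial element \<open>b\<^sup>\<alpha>\<close>, which forces \<open>{0, 1, 3}\<close> to be a translate of
  \<open>{0, -1, -3}\<close> modulo \<open>n\<close>, or the latter to have a nontrivial period.
\<close>

lemma not_BCI_dihedral_group_ge_6:
  assumes n: "n \<ge> 6"
  shows "\<not> BCI_group (dihedral_group n)"
proof
  assume BCI: "BCI_group (dihedral_group n)"
  interpret group "dihedral_group n" by (rule group_dihedral_group) (use n in simp)
  let ?D = "dihedral_group n"
  let ?b = "(0, True) :: int \<times> bool"
  have one: "\<one>\<^bsub>?D\<^esub> = (0, False)" by (simp add: dihedral_group_def)
  define S where "S = dihedral_set {0, 1, 3} {0, 1, 3}"
  \<comment> \<open>This is the set of inverses of \<open>S\<close>: rotation exponents are negated
    modulo \<open>n\<close>, while reflections are involutions.\<close>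
  define T where "T = dihedral_set {0, int n - 1, int n - 3} {0, 1, 3}"
  have S: "S \<subseteq> carrier ?D" and T: "T \<subseteq> carrier ?D" and b: "?b \<in> carrier ?D"
    using n by (auto simp: S_def T_def dihedral_set_def carrier_dihedral_group)
  have m: "(- 1) mod int n = int n - 1" "(- 3) mod int n = int n - 3"
    using n by (simp_all add: zmod_zminus1_eq_if)
  have inv: "inv\<^bsub>?D\<^esub> (i, False) = ((- i) mod int n, False)" "inv\<^bsub>?D\<^esub> (i, True) = (i, True)"
    if "i \<in> {0, 1, 3}" for i
    using that n m by (auto intro!: inv_equality simp: mult_dihedral_group carrier_dihedral_group one)
  have "m_inv ?D ` S = T"
    unfolding S_def T_def dihedral_set_def using m by (auto simp: image_Un image_iff inv)
  then have "BCay ?D S \<cong>\<^sub>g BCay ?D T" using BCay_m_inv_iso[OF S] by simp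
  then obtain g \<alpha> where g: "g \<in> carrier ?D" and \<alpha>: "\<alpha> \<in> auto ?D" and Teq: "T = g <#\<^bsub>?D\<^esub> (\<alpha> ` S)"
    using BCI S T unfolding BCI_group_def BCI_graph_def by blast
  have hom: "\<alpha> \<in> hom ?D ?D" and inj: "inj_on \<alpha> (carrier ?D)"
    using \<alpha> by (auto simp: auto_def Bij_def bij_betw_def)
  interpret \<alpha>: group_hom ?D ?D \<alpha> using hom by unfold_locales
  obtain v r where vr: "\<alpha> ?b = (v, r)" by (cases "\<alpha> ?b")
  have v: "v \<in> {0..<int n}" using \<alpha>.hom_closed[OF b] unfolding vr by (simp add: carrier_dihedral_group)
  have ne: "(v, r) \<noteq> (0, False)"
  proof
    assume "(v, r) = (0, False)"
    then have "\<alpha> ?b = \<alpha> (0, False)" using vr \<alpha>.hom_one by (simp add: one)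
    then have "?b = (0, False)" using inj_onD[OF inj _ b one_closed] by (simp add: one)
    then show False by simp
  qed
  \<comment> \<open>Since \<open>S\<close> is stable under right multiplication by \<open>b\<close>,
    its image \<open>T\<close> is stable under right multiplication by the image of
    \<open>b\<close>.\<close>
  have per: "t \<otimes>\<^bsub>?D\<^esub> (v, r) \<in> T" if "t \<in> T" for t
  proof -
    obtain s where s: "s \<in> S" "t = g \<otimes>\<^bsub>?D\<^esub> \<alpha> s"
      using \<open>t \<in> T\<close> unfolding Teq l_coset_def by blast
    have sc: "s \<in> carrier ?D" using s(1) S by blast
    have "s \<otimes>\<^bsub>?D\<^esub> ?b \<in> S"
      using s(1) n by (auto simp: S_def dihedral_set_def mult_dihedral_group)
    moreover have "t \<otimes>\<^bsub>?D\<^esub> (v, r) = g \<otimes>\<^bsub>?D\<^esub> \<alpha> (s \<otimes>\<^bsub>?D\<^esub> ?b)"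
      unfolding s(2) \<alpha>.hom_mult[OF sc b] vr[symmetric]
      by (rule m_assoc[OF g \<alpha>.hom_closed[OF sc] \<alpha>.hom_closed[OF b]])
    ultimately show ?thesis unfolding Teq l_coset_def by blast
  qed
  have mem: "((0 + v) mod int n, r) \<in> T" "((int n - 1 + v) mod int n, r) \<in> T"
    "((int n - 3 + v) mod int n, r) \<in> T"
    using per[of "(0, False)"] per[of "(int n - 1, False)"] per[of "(int n - 3, False)"]
    by (auto simp: T_def dihedral_set_def mult_dihedral_group)
  \<comment> \<open>All sums below lie under \<open>2 n\<close>, so reduction wraps around at most
    once and becomes a linear case distinction.\<close>
  have red: "k mod int n = (if k < int n then k else k - int n)" if "0 \<le> k" "k < 2 * int n" for k
  proof (cases "k < int n")
    case True
    then show ?thesis using mod_pos_pos_trivial[OF that(1) True] by (simp only: if_True)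
  next
    case False
    have "k mod int n = (k - int n) mod int n" by (rule mod_pos_geq) (use False n in linarith)+
    also have "\<dots> = k - int n" by (rule mod_pos_pos_trivial) (use False that in linarith)+
    finally show ?thesis using False by (simp only: if_False)
  qed
  have e0: "(0 + v) mod int n = v" using red[of "0 + v"] v by simp
  have e1: "(int n - 1 + v) mod int n = (if v = 0 then int n - 1 else v - 1)"
    by (subst red) (use v n in auto)
  have e3: "(int n - 3 + v) mod int n = (if v < 3 then int n - 3 + v else v - 3)"
    by (subst red) (use v n in auto)
  \<comment> \<open>A rotation \<open>(v, r)\<close> would be a nonzero period of
    \<open>{0, -1, -3}\<close>; a reflection would translate this set into \<open>{0, 1, 3}\<close>.
    For \<open>v = 1\<close> the latter needs \<open>n - 2 = 3\<close>, which
    \<open>n \<ge> 6\<close> excludes; modulo 5 the translation exists.\<close>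
  show False
    using mem v n ne unfolding e0 e1 e3 by (cases r) (auto simp: T_def dihedral_set_def split: if_splits)
qed

lemma not_BCI_dihedral_group_4: "\<not> BCI_group (dihedral_group 4)"
proof
  assume BCI: "BCI_group (dihedral_group 4)"
  interpret group "dihedral_group 4" by (rule group_dihedral_group) simp
  let ?D = "dihedral_group 4"
  let ?a = "(1, False) :: int \<times> bool"
  let ?z = "(2, False) :: int \<times> bool"
  let ?b = "(0, True) :: int \<times> bool"
  let ?e = "(0, False) :: int \<times> bool"
  have c: "carrier ?D = {(0, False), (1, False), (2, False), (3, False),
      (0, True), (1, True), (2, True), (3, True)}"
    by (auto simp: carrier_dihedral_group)
  have one: "\<one>\<^bsub>?D\<^esub> = ?e" by (simp add: dihedral_group_def)
  let ?\<phi> = "\<lambda>(i, r). if i < 2 then (i + 2 * of_bool r, False) else ((2 - i - 2 * of_bool r) mod 4, True) :: int \<times> bool"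
  have inv: "inv\<^bsub>?D\<^esub> (i, False) = ((- i) mod 4, False)" "inv\<^bsub>?D\<^esub> (i, True) = (i, True)"
    if "i \<in> {0, 1, 2, 3}" for i
    using that by (auto intro!: inv_equality simp: mult_dihedral_group c one)
  \<comment> \<open>\<open>\<phi>\<close> maps cosets of \<open>{1, a\<^sup>2}\<close> to right cosets of \<open>{1, b}\<close>\<close>
  have \<phi>: "bij_betw ?\<phi> (carrier ?D) (carrier ?D)"
    unfolding c by (rule bij_betw_imageI) (simp_all add: inj_on_def, auto)
  have sub: "{?e, ?z} \<subseteq> carrier ?D" "{?e, ?b} \<subseteq> carrier ?D" by (simp_all add: c)
  have "BCay ?D {?e, ?z} \<cong>\<^sub>g BCay ?D {?e, ?b}"
  \<comment> \<open>Both sets are subgroups of order 2, so adjacency means lying in the same right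
    coset, and one coset-preserving bijection serves both parts.\<close>
  proof (rule BCay_isoI[OF sub \<phi> \<phi>])
    fix x y assume "x \<in> carrier ?D" "y \<in> carrier ?D"
    then show "y \<otimes>\<^bsub>?D\<^esub> inv\<^bsub>?D\<^esub> x \<in> {?e, ?z} \<longleftrightarrow> ?\<phi> y \<otimes>\<^bsub>?D\<^esub> inv\<^bsub>?D\<^esub> (?\<phi> x) \<in> {?e, ?b}"
      unfolding c by (elim insertE emptyE) (simp_all add: inv mult_dihedral_group)
  qed
  moreover have "BCI_graph ?D {?e, ?z}" using BCI sub(1) by (simp only: BCI_group_def)
  ultimately have "\<exists>g\<in>carrier ?D. \<exists>\<alpha>\<in>auto ?D. {?e, ?b} = g <#\<^bsub>?D\<^esub> (\<alpha> ` {?e, ?z})"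
    using sub(2) unfolding BCI_graph_def by (elim allE[of _ "{?e, ?b}"] impE) assumption+
  then obtain g \<alpha> where g: "g \<in> carrier ?D" and \<alpha>: "\<alpha> \<in> auto ?D"
    and eq: "{?e, ?b} = g <#\<^bsub>?D\<^esub> (\<alpha> ` {?e, ?z})"
    by (elim bexE)
  interpret \<alpha>: group_hom ?D ?D \<alpha> using \<alpha> by unfold_locales (simp add: auto_def)
  have e: "\<alpha> ?e = ?e" using \<alpha>.hom_one by (simp add: one)
  have "?a \<otimes>\<^bsub>?D\<^esub> ?a = ?z" by (simp add: mult_dihedral_group)
  then have z: "\<alpha> ?z = \<alpha> ?a \<otimes>\<^bsub>?D\<^esub> \<alpha> ?a" using \<alpha>.hom_mult[of ?a ?a] by (simp add: c)
  \<comment> \<open>A square in the dihedral group is always a rotation.\<close>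
  have "\<not> snd (\<alpha> ?z)" unfolding z by (cases "\<alpha> ?a") (simp add: mult_dihedral_group)
  then have snd: "snd (g \<otimes>\<^bsub>?D\<^esub> \<alpha> ?z) = snd (g \<otimes>\<^bsub>?D\<^esub> \<alpha> ?e)"
    unfolding e by (cases g; cases "\<alpha> ?z") (simp add: mult_dihedral_group)
  have "{?e, ?b} = {g \<otimes>\<^bsub>?D\<^esub> \<alpha> ?e, g \<otimes>\<^bsub>?D\<^esub> \<alpha> ?z}" using eq by (auto simp: l_coset_def)
  \<comment> \<open>The right side has a single reflection flag, whereas \<open>{1, b}\<close> has
    both.\<close>
  then have "snd ` {?e, ?b} = snd ` {g \<otimes>\<^bsub>?D\<^esub> \<alpha> ?e, g \<otimes>\<^bsub>?D\<^esub> \<alpha> ?z}" by (rule arg_cong)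
  then show False unfolding image_insert image_empty snd by auto
qed

theorem theorem6:
  fixes n :: nat
  assumes "n \<ge> 2"
  shows "BCI_group (dihedral_group n) \<longleftrightarrow> n \<in> {2, 3, 5}"
proof -
  have "n = 2 \<or> n = 3 \<or> n = 4 \<or> n = 5 \<or> n \<ge> 6" using assms by linarith
  then show ?thesis
    using BCI_dihedral_group_2 BCI_dihedral_group_3 BCI_dihedral_group_5
      not_BCI_dihedral_group_4 not_BCI_dihedral_group_ge_6 by auto
qed

end
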